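(* For $0<\kappa<c/2$ let $\phi(\cdot;c,\kappa)$ be the solitary wave profile described in the context. Then there exists a value $G_{c,\kappa}\in(c-\kappa,c)$ with $E(G_{c,\kappa},0)=E(\kappa,0)$, where $$E(\phi,\phi_\xi)=\tfrac12\phi_\xi^2-\tfrac12\phi^2-\kappa(c-\kappa)\ln(c-\phi),$$ such that $$\kappa<\phi(\xi;c,\kappa)\le G_{c,\kappa}<c\quad\text{for all }\xi\in\mathbb R,\qquad G_{c,\kappa}=\max_{\xi\in\mathbb R}\phi(\xi;c,\kappa).$$ Moreover, for fixed $c>0$ the value $G_{c,\kappa}$ increases to $c$ as $\kappa$ decreases to $0$ (with $\kappa\in(0,c/2)$), and for fixed $\kappa>0$ the value $G_{c,\kappa}$ is increasing in $c$ (with $c>2\kappa$).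
   Context: The solitary wave profile: for $0<\kappa<c/2$, $\phi(\cdot;c,\kappa)\in C^\infty(\mathbb R)$ is the solution, unique up to translation in $\xi$, of $\phi_{\xi\xi}-\phi+\frac{\kappa(c-\kappa)}{c-\phi}=0$ with $\phi(\xi)\to\kappa$ exponentially as $\xi\to\pm\infty$ and $\kappa<\phi(\xi)<c$ for all $\xi$. It is the homoclinic orbit to $(\kappa,0)$, on which $E(\phi,\phi_\xi)=E(\kappa,0)$. The translation is fixed by $\phi_\xi(0)=0$. *)

theory Defs
  imports "HOL-Analysis.Analysis" "HOL-Library.Landau_Symbols"
begin

definition wave_energy :: "real \<Rightarrow> real \<Rightarrow> real \<Rightarrow> real \<Rightarrow> real" where
  "wave_energy c \<kappa> u v = v\<^sup>2 / 2 - u\<^sup>2 / 2 - \<kappa> * (c - \<kappa>) * ln (c - u)"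

(* Meant for 0 < \<kappa> < c/2, where it determines \<phi> uniquely.  The limits at both ends are
   expressed through at_infinity, which on the reals is the supremum of at_top and at_bot.
   That the orbit lies on the energy level of (\<kappa>, 0) is a consequence, not a requirement. *)
definition solitary_wave_profile :: "real \<Rightarrow> real \<Rightarrow> (real \<Rightarrow> real) \<Rightarrow> bool" where
  "solitary_wave_profile c \<kappa> \<phi> \<longleftrightarrow>
     (\<forall>n. (deriv ^^ n) \<phi> differentiable_on UNIV) \<and>
     (\<forall>\<xi>. deriv (deriv \<phi>) \<xi> - \<phi> \<xi> + \<kappa> * (c - \<kappa>) / (c - \<phi> \<xi>) = 0) \<and>
     (\<exists>\<alpha>>0. (\<lambda>\<xi>. \<phi> \<xi> - \<kappa>) \<in> O[at_infinity](\<lambda>\<xi>. exp (- \<alpha> * \<bar>\<xi>\<bar>))) \<and>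
     (\<forall>\<xi>. \<kappa> < \<phi> \<xi> \<and> \<phi> \<xi> < c) \<and>
     deriv \<phi> 0 = 0"

end

theory Submission
  imports Defs "HOL-Real_Asymp.Real_Asymp"
begin

text \<open>
  Write \<open>H\<close> (below \<open>gap\<close>) for the potential energy \<open>u \<mapsto> E(u, 0)\<close> measured from its value at \<open>\<kappa>\<close>.
  Its derivative is \<open>(u - \<kappa>) (u - (c - \<kappa>)) / (c - u)\<close>, so on \<open>(\<kappa>, c)\<close> it falls from \<open>0\<close> to a
  negative minimum at \<open>c - \<kappa>\<close> and then rises to \<open>\<infinity>\<close>.  Hence it has exactly one zero
  \<open>G\<close> (below \<open>crest\<close>) in \<open>(\<kappa>, c)\<close>; this zero lies in \<open>(c - \<kappa>, c)\<close>, and the sign of \<open>H\<close> at \<open>u\<close> is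
  the sign of \<open>u - G\<close> (\<open>gap_sgn\<close>).

  A profile conserves the energy, and its decay to \<open>\<kappa>\<close> puts it on the level of \<open>(\<kappa>, 0)\<close>
  (\<open>profile_energy\<close>).  So \<open>H(\<phi>) = - \<phi>'\<^sup>2 / 2 \<le> 0\<close>, that is \<open>\<phi> \<le> G\<close>, with equality at the
  critical point \<open>0\<close>.

  The sign rule also turns the dependence of \<open>G\<close> on the parameters into that of \<open>H\<close>
  at fixed \<open>u\<close>: wherever moving a parameter makes \<open>H\<close> negative at the old zero, the new zero
  lies further right.  The two parameter derivatives have a fixed sign, because
  \<open>\<partial>H/\<partial>\<kappa> = (c - 2 \<kappa>) ln x > 0\<close> and \<open>\<partial>H/\<partial>c = \<kappa> (ln x + 1 - x) < 0\<close>
  for \<open>x = (c - \<kappa>) / (c - u) > 1\<close>.  The limit \<open>\<kappa> \<rightarrow> 0\<close> follows by squeezing from \<open>c - \<kappa> < G < c\<close>.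
\<close>

definition gap :: "real \<Rightarrow> real \<Rightarrow> real \<Rightarrow> real" where
  "gap c \<kappa> u = wave_energy c \<kappa> u 0 - wave_energy c \<kappa> \<kappa> 0"

lemma gap_eq: "gap c \<kappa> u = (\<kappa>\<^sup>2 - u\<^sup>2) / 2 + \<kappa> * (c - \<kappa>) * (ln (c - \<kappa>) - ln (c - u))"
  by (simp add: gap_def wave_energy_def field_simps)

lemma gap_self [simp]: "gap c \<kappa> \<kappa> = 0"
  by (simp add: gap_def)

lemma gap_deriv:
  assumes "u < c"
  shows "(gap c \<kappa> has_real_derivative (u - \<kappa>) * (u - (c - \<kappa>)) / (c - u)) (at u)"
proof -
  have "((\<lambda>u. (\<kappa>\<^sup>2 - u\<^sup>2) / 2 + \<kappa> * (c - \<kappa>) * (ln (c - \<kappa>) - ln (c - u)))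
      has_real_derivative - u + \<kappa> * (c - \<kappa>) / (c - u)) (at u)"
    using assms by (auto intro!: derivative_eq_intros)
  moreover have "- u + \<kappa> * (c - \<kappa>) / (c - u) = (u - \<kappa>) * (u - (c - \<kappa>)) / (c - u)"
    using assms by (simp add: field_simps)
  ultimately show ?thesis
    by (simp add: gap_eq[abs_def])
qed

lemma gap_neg_left:
  assumes "0 < \<kappa>" "\<kappa> < u" "u \<le> c - \<kappa>"
  shows "gap c \<kappa> u < 0"
proof -
  have "gap c \<kappa> u < gap c \<kappa> \<kappa>"
  proof (rule DERIV_neg_imp_decreasing_open[OF \<open>\<kappa> < u\<close>])
    fix x assume "\<kappa> < x" "x < u"
    with assms have "(x - \<kappa>) * (x - (c - \<kappa>)) / (c - x) < 0"
      by (intro divide_neg_pos mult_pos_neg) auto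
    with gap_deriv[of x c \<kappa>] \<open>x < u\<close> assms
    show "\<exists>y. (gap c \<kappa> has_real_derivative y) (at x) \<and> y < 0" by auto
  next
    show "continuous_on {\<kappa>..u} (gap c \<kappa>)"
      using assms by (intro continuous_at_imp_continuous_on ballI)
        (auto intro!: DERIV_isCont[OF gap_deriv])
  qed
  then show ?thesis by simp
qed

lemma gap_increasing_right:
  assumes "0 < \<kappa>" "\<kappa> < c / 2" "c - \<kappa> \<le> u" "u < v" "v < c"
  shows "gap c \<kappa> u < gap c \<kappa> v"
proof (rule DERIV_pos_imp_increasing_open[OF \<open>u < v\<close>])
  fix x assume "u < x" "x < v"
  with assms have "(x - \<kappa>) * (x - (c - \<kappa>)) / (c - x) > 0"
    by (intro divide_pos_pos mult_pos_pos) auto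
  with gap_deriv[of x c \<kappa>] \<open>x < v\<close> assms
  show "\<exists>y. (gap c \<kappa> has_real_derivative y) (at x) \<and> y > 0" by auto
next
  show "continuous_on {u..v} (gap c \<kappa>)"
    using assms by (intro continuous_at_imp_continuous_on ballI)
      (auto intro!: DERIV_isCont[OF gap_deriv])
qed

lemma gap_zero_exists:
  assumes "0 < \<kappa>" "\<kappa> < c / 2"
  shows "\<exists>u. c - \<kappa> < u \<and> u < c \<and> gap c \<kappa> u = 0"
proof -
  \<comment> \<open>The exponent is chosen so that at \<open>v\<close> the logarithmic term of the gap equals \<open>c\<^sup>2\<close>, which outweighs \<open>v\<^sup>2 / 2\<close>.\<close>
  define e where "e = exp (- (c\<^sup>2 / (\<kappa> * (c - \<kappa>))))"
  define v where "v = c - (c - \<kappa>) * e"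
  have pos: "0 < c - \<kappa>" "0 < c\<^sup>2 / (\<kappa> * (c - \<kappa>))"
    using assms by auto
  then have e: "0 < e" "e < 1"
    by (simp_all only: e_def exp_gt_zero exp_less_one_iff neg_less_0_iff_less)
  then have "0 < (c - \<kappa>) * e" "(c - \<kappa>) * e < c - \<kappa>"
    using pos(1) by simp_all
  then have v: "\<kappa> < v" "v < c"
    by (simp_all add: v_def)
  have "ln (c - v) = ln (c - \<kappa>) - c\<^sup>2 / (\<kappa> * (c - \<kappa>))"
    using pos by (simp add: v_def e_def ln_mult)
  then have "gap c \<kappa> v = (\<kappa>\<^sup>2 - v\<^sup>2) / 2 + c\<^sup>2"
    using assms by (simp add: gap_eq)
  moreover have "v\<^sup>2 \<le> c\<^sup>2"
    using v assms by (intro power_mono) auto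
  moreover have "\<kappa>\<^sup>2 > 0" "c\<^sup>2 \<ge> 0"
    using assms by simp_all
  ultimately have "gap c \<kappa> v > 0"
    by argo
  then have "c - \<kappa> < v"
    using gap_neg_left[of \<kappa> v c] v assms by force
  have neg: "gap c \<kappa> (c - \<kappa>) < 0"
    using assms by (intro gap_neg_left) auto
  have "\<exists>u\<ge>c - \<kappa>. u \<le> v \<and> gap c \<kappa> u = 0"
    using neg \<open>gap c \<kappa> v > 0\<close> \<open>c - \<kappa> < v\<close> \<open>v < c\<close>
    by (intro IVT') (auto intro!: continuous_at_imp_continuous_on DERIV_isCont[OF gap_deriv])
  then show ?thesis
    using neg \<open>v < c\<close> by (metis le_less_trans less_irrefl order_le_less)
qed

definition crest :: "real \<Rightarrow> real \<Rightarrow> real" where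
  "crest c \<kappa> = (SOME u. c - \<kappa> < u \<and> u < c \<and> gap c \<kappa> u = 0)"

lemma crest:
  assumes "0 < \<kappa>" "\<kappa> < c / 2"
  shows "c - \<kappa> < crest c \<kappa>" "crest c \<kappa> < c" "gap c \<kappa> (crest c \<kappa>) = 0"
  using someI_ex[OF gap_zero_exists[OF assms]] by (auto simp: crest_def)

lemma gap_sgn:
  assumes "0 < \<kappa>" "\<kappa> < c / 2" "\<kappa> < u" "u < c"
  shows "sgn (gap c \<kappa> u) = sgn (u - crest c \<kappa>)"
proof (cases "u \<le> c - \<kappa>")
  case True
  then show ?thesis
    using gap_neg_left[of \<kappa> u c] crest(1)[of \<kappa> c] assms by (simp add: sgn_if)
next
  case False
  then show ?thesis
    using gap_increasing_right[of \<kappa> c u "crest c \<kappa>"] gap_increasing_right[of \<kappa> c "crest c \<kappa>" u]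
      crest[of \<kappa> c] assms
    by (cases u "crest c \<kappa>" rule: linorder_cases) (auto simp: sgn_if)
qed

lemma gap_neg_iff:
  assumes "0 < \<kappa>" "\<kappa> < c / 2" "\<kappa> < u" "u < c"
  shows "gap c \<kappa> u < 0 \<longleftrightarrow> u < crest c \<kappa>"
  using gap_sgn[OF assms] by (metis diff_less_0_iff_less sgn_less)

lemma gap_zero_iff:
  assumes "0 < \<kappa>" "\<kappa> < c / 2" "\<kappa> < u" "u < c"
  shows "gap c \<kappa> u = 0 \<longleftrightarrow> u = crest c \<kappa>"
  using gap_sgn[OF assms] by (metis eq_iff_diff_eq_0 sgn_zero_iff)

text \<open>
  The contributions of \<open>\<kappa>\<^sup>2 / 2\<close> and of \<open>ln (c - \<kappa>)\<close> to the derivative in \<open>\<kappa>\<close> cancel, which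
  leaves \<open>(c - 2 \<kappa>) ln ((c - \<kappa>) / (c - u))\<close>.
\<close>
lemma gap_increasing_kappa:
  assumes "k < l" "l < c / 2" "l < u" "u < c"
  shows "gap c k u < gap c l u"
proof (rule DERIV_pos_imp_increasing[OF \<open>k < l\<close>])
  fix x assume x: "k \<le> x" "x \<le> l"
  have "((\<lambda>x. (x\<^sup>2 - u\<^sup>2) / 2 + x * (c - x) * (ln (c - x) - ln (c - u)))
      has_real_derivative x + ((c - 2 * x) * (ln (c - x) - ln (c - u)) - x * (c - x) / (c - x))) (at x)"
    using x assms
    by (auto intro!: derivative_eq_intros simp: algebra_simps diff_divide_distrib add_divide_distrib)
  then have "((\<lambda>x. (x\<^sup>2 - u\<^sup>2) / 2 + x * (c - x) * (ln (c - x) - ln (c - u)))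
      has_real_derivative (c - 2 * x) * (ln (c - x) - ln (c - u))) (at x)"
    using x assms by simp
  moreover have "(c - 2 * x) * (ln (c - x) - ln (c - u)) > 0"
    using x assms by (intro mult_pos_pos) auto
  ultimately show "\<exists>y. ((\<lambda>x. gap c x u) has_real_derivative y) (at x) \<and> y > 0"
    by (auto simp: gap_eq)
qed

lemma gap_decreasing_speed:
  assumes "0 < \<kappa>" "\<kappa> < u" "u < a" "a < b"
  shows "gap b \<kappa> u < gap a \<kappa> u"
proof (rule DERIV_neg_imp_decreasing[OF \<open>a < b\<close>])
  fix x assume x: "a \<le> x" "x \<le> b"
  define q where "q = (x - \<kappa>) / (x - u)"
  have q: "q > 0" "q \<noteq> 1"
    using x assms by (auto simp: q_def)
  have "((\<lambda>x. (\<kappa>\<^sup>2 - u\<^sup>2) / 2 + \<kappa> * (x - \<kappa>) * (ln (x - \<kappa>) - ln (x - u)))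
      has_real_derivative \<kappa> * (ln (x - \<kappa>) - ln (x - u)) + \<kappa> * (x - \<kappa>) * (1 / (x - \<kappa>) - 1 / (x - u)))
      (at x)"
    using x assms by (auto intro!: derivative_eq_intros)
  moreover have "\<kappa> * (x - \<kappa>) * (1 / (x - \<kappa>) - 1 / (x - u)) = \<kappa> * (1 - q)"
  proof -
    have "\<kappa> * A * (1 / A - 1 / B) = \<kappa> * (1 - A / B)" if "A \<noteq> 0" "B \<noteq> 0" for A B :: real
      using that by (simp add: field_simps)
    then show ?thesis
      using x assms by (simp add: q_def)
  qed
  moreover have "ln (x - \<kappa>) - ln (x - u) = ln q"
    using x assms by (simp add: q_def ln_div)
  moreover have "ln q < q - 1"
    using q ln_le_minus_one[of q] ln_eq_minus_one[of q] by fastforce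
  then have "\<kappa> * (ln q + 1 - q) < 0"
    using assms by (intro mult_pos_neg) auto
  ultimately show "\<exists>y. ((\<lambda>x. gap x \<kappa> u) has_real_derivative y) (at x) \<and> y < 0"
    by (auto simp: gap_eq algebra_simps)
qed

lemma crest_antimono_kappa:
  assumes "0 < k" "k < l" "l < c / 2"
  shows "crest c l < crest c k"
proof -
  note l = crest[of l c]
  have "gap c k (crest c l) < gap c l (crest c l)"
    using l assms by (intro gap_increasing_kappa) auto
  then show ?thesis
    using gap_neg_iff[of k c "crest c l"] l assms by auto
qed

lemma crest_mono_speed:
  assumes "0 < \<kappa>" "2 * \<kappa> < a" "a < b"
  shows "crest a \<kappa> < crest b \<kappa>"
proof -
  note a = crest[of \<kappa> a]
  have "gap b \<kappa> (crest a \<kappa>) < gap a \<kappa> (crest a \<kappa>)"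
    using a assms by (intro gap_decreasing_speed) auto
  then show ?thesis
    using gap_neg_iff[of \<kappa> b "crest a \<kappa>"] a assms by auto
qed

lemma crest_tendsto:
  assumes "c > 0"
  shows "((\<lambda>\<kappa>. crest c \<kappa>) \<longlongrightarrow> c) (at_right 0)"
proof (rule tendsto_sandwich)
  have small: "\<forall>\<^sub>F \<kappa> in at_right 0. 0 < \<kappa> \<and> \<kappa> < c / 2"
    using eventually_at_right_real[of 0 "c / 2"] assms by simp
  show "\<forall>\<^sub>F \<kappa> in at_right 0. c - \<kappa> \<le> crest c \<kappa>" "\<forall>\<^sub>F \<kappa> in at_right 0. crest c \<kappa> \<le> c"
    using small by (auto elim!: eventually_mono dest: crest(1,2))
  show "((\<lambda>\<kappa>. c - \<kappa>) \<longlongrightarrow> c) (at_right 0)"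
    by (auto intro!: tendsto_eq_intros)
qed simp

text \<open>
  The definition gives the decay of \<open>\<phi>\<close> but not of its derivative.  The mean value theorem on
  \<open>[n, n + 1]\<close> supplies points at which the derivative tends to \<open>0\<close>, and since the energy is
  constant, its limit along these points is its value everywhere.
\<close>
lemma profile_energy:
  assumes "solitary_wave_profile c \<kappa> \<phi>" "\<kappa> < c"
  shows "wave_energy c \<kappa> (\<phi> \<xi>) (deriv \<phi> \<xi>) = wave_energy c \<kappa> \<kappa> 0"
proof -
  let ?E = "\<lambda>x. wave_energy c \<kappa> (\<phi> x) (deriv \<phi> x)"
  have smooth: "(deriv ^^ n) \<phi> differentiable_on UNIV"
    and ode: "deriv (deriv \<phi>) x = \<phi> x - \<kappa> * (c - \<kappa>) / (c - \<phi> x)"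
    and range: "\<phi> x < c" for n x
    using assms(1) by (auto simp: solitary_wave_profile_def algebra_simps)
  have d0: "(\<phi> has_real_derivative deriv \<phi> x) (at x)" for x
    using smooth[of 0] by (simp add: differentiable_on_def DERIV_deriv_iff_real_differentiable)
  have d1: "(deriv \<phi> has_real_derivative deriv (deriv \<phi>) x) (at x)" for x
    using smooth[of 1] by (simp add: differentiable_on_def DERIV_deriv_iff_real_differentiable)
  have "(?E has_real_derivative 0) (at x)" for x
  proof -
    have "(?E has_real_derivative
        deriv \<phi> x * (deriv (deriv \<phi>) x - \<phi> x + \<kappa> * (c - \<kappa>) / (c - \<phi> x))) (at x)"
      unfolding wave_energy_def using range[of x]
      by (auto intro!: derivative_eq_intros d0 d1 simp: distrib_left right_diff_distrib diff_divide_distrib)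
    then show ?thesis by (simp add: ode)
  qed
  then have const: "?E x = ?E y" for x y
    using DERIV_isconst_all[of ?E] by blast
  obtain \<alpha> where \<alpha>: "\<alpha> > 0" "(\<lambda>\<xi>. \<phi> \<xi> - \<kappa>) \<in> O[at_infinity](\<lambda>\<xi>. exp (- \<alpha> * \<bar>\<xi>\<bar>))"
    using assms(1) by (auto simp: solitary_wave_profile_def)
  have "(\<lambda>\<xi>. \<phi> \<xi> - \<kappa>) \<in> O[at_top](\<lambda>\<xi>. exp (- \<alpha> * \<bar>\<xi>\<bar>))"
    using \<alpha>(2) by (rule landau_o.big.filter_mono[OF at_top_le_at_infinity])
  then obtain K where "\<forall>\<^sub>F x in at_top. norm (\<phi> x - \<kappa>) \<le> K * norm (exp (- \<alpha> * \<bar>x\<bar>))"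
    by (elim landau_o.bigE)
  moreover have "((\<lambda>x. exp (- \<alpha> * \<bar>x\<bar>)) \<longlongrightarrow> 0) at_top"
    using \<alpha>(1) by real_asymp
  then have "((\<lambda>x. K * norm (exp (- \<alpha> * \<bar>x\<bar>))) \<longlongrightarrow> 0) at_top"
    by (intro tendsto_mult_right_zero tendsto_norm_zero)
  ultimately have "((\<lambda>x. \<phi> x - \<kappa>) \<longlongrightarrow> 0) at_top"
    by (rule Lim_null_comparison)
  then have lim: "(\<phi> \<longlongrightarrow> \<kappa>) at_top"
    by (simp add: Lim_null[symmetric])
  have "\<exists>z. real n < z \<and> z < real n + 1 \<and> \<phi> (real n + 1) - \<phi> (real n) = deriv \<phi> z" for n
    using MVT2[of "real n" "real n + 1" \<phi> "deriv \<phi>"] d0 by auto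
  then obtain z where z: "real n < z n"
    "\<phi> (real n + 1) - \<phi> (real n) = deriv \<phi> (z n)" for n
    by metis
  have "filterlim z at_top sequentially"
    by (rule filterlim_at_top_mono[OF filterlim_real_sequentially])
      (auto intro!: always_eventually less_imp_le z)
  then have "(\<lambda>n. \<phi> (z n)) \<longlonglongrightarrow> \<kappa>"
    by (rule filterlim_compose[OF lim])
  moreover have "filterlim (\<lambda>n. real n + 1) at_top sequentially"
    by real_asymp
  then have "(\<lambda>n. \<phi> (real n + 1) - \<phi> (real n)) \<longlonglongrightarrow> \<kappa> - \<kappa>"
    by (intro tendsto_diff filterlim_compose[OF lim] filterlim_real_sequentially)
  then have "(\<lambda>n. deriv \<phi> (z n)) \<longlonglongrightarrow> 0"
    by (simp add: z)
  ultimately have "(\<lambda>n. ?E (z n)) \<longlonglongrightarrow> wave_energy c \<kappa> \<kappa> 0"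
    unfolding wave_energy_def using assms(2) by (intro tendsto_intros) auto
  moreover have "(\<lambda>n. ?E (z n)) = (\<lambda>n. ?E \<xi>)"
    using const by blast
  ultimately show ?thesis
    by (simp add: LIMSEQ_const_iff)
qed

lemma profile_crest:
  assumes "solitary_wave_profile c \<kappa> \<phi>" "0 < \<kappa>" "\<kappa> < c / 2"
  shows "\<phi> \<xi> \<le> crest c \<kappa>" "\<phi> 0 = crest c \<kappa>"
proof -
  have range: "\<kappa> < \<phi> x" "\<phi> x < c" for x
    using assms(1) by (auto simp: solitary_wave_profile_def)
  have gap: "gap c \<kappa> (\<phi> x) = - (deriv \<phi> x)\<^sup>2 / 2" for x
    using profile_energy[OF assms(1), of x] assms(2,3) by (simp add: gap_def wave_energy_def)
  then have "gap c \<kappa> (\<phi> \<xi>) \<le> 0" by simp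
  then show "\<phi> \<xi> \<le> crest c \<kappa>"
    using gap_neg_iff[OF assms(2,3) range] gap_zero_iff[OF assms(2,3) range]
    by (metis order_le_less)
  have "gap c \<kappa> (\<phi> 0) = 0"
    using gap assms(1) by (simp add: solitary_wave_profile_def)
  then show "\<phi> 0 = crest c \<kappa>"
    using gap_zero_iff[OF assms(2,3) range] by blast
qed

theorem mainTheorem4:
  shows "\<exists>G :: real \<Rightarrow> real \<Rightarrow> real.
    (\<forall>c \<kappa>. 0 < \<kappa> \<and> \<kappa> < c / 2 \<longrightarrow>
       G c \<kappa> \<in> {c - \<kappa> <..< c} \<and>
       wave_energy c \<kappa> (G c \<kappa>) 0 = wave_energy c \<kappa> \<kappa> 0 \<and>
       (\<forall>\<phi>. solitary_wave_profile c \<kappa> \<phi> \<longrightarrow>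
          (\<forall>\<xi>. \<kappa> < \<phi> \<xi> \<and> \<phi> \<xi> \<le> G c \<kappa> \<and> G c \<kappa> < c) \<and>
          (\<exists>\<xi>. \<phi> \<xi> = G c \<kappa>))) \<and>
    (\<forall>c>0. strict_antimono_on {0 <..< c / 2} (\<lambda>\<kappa>. G c \<kappa>) \<and>
       ((\<lambda>\<kappa>. G c \<kappa>) \<longlongrightarrow> c) (at_right 0)) \<and>
    (\<forall>\<kappa>>0. strict_mono_on {2 * \<kappa> <..} (\<lambda>c. G c \<kappa>))"
proof (intro exI[of _ crest] conjI allI impI)
  fix c \<kappa> :: real assume "0 < \<kappa> \<and> \<kappa> < c / 2"
  then have \<kappa>: "0 < \<kappa>" "\<kappa> < c / 2" by auto
  show "crest c \<kappa> \<in> {c - \<kappa> <..< c}"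
    using crest[OF \<kappa>] by simp
  show "wave_energy c \<kappa> (crest c \<kappa>) 0 = wave_energy c \<kappa> \<kappa> 0"
    using crest(3)[OF \<kappa>] by (simp add: gap_def)
  fix \<phi> assume \<phi>: "solitary_wave_profile c \<kappa> \<phi>"
  show "\<exists>\<xi>. \<phi> \<xi> = crest c \<kappa>"
    using profile_crest(2)[OF \<phi> \<kappa>] by blast
  fix \<xi>
  show "\<kappa> < \<phi> \<xi>" "\<phi> \<xi> \<le> crest c \<kappa>" "crest c \<kappa> < c"
    using \<phi> profile_crest(1)[OF \<phi> \<kappa>] crest(2)[OF \<kappa>] by (auto simp: solitary_wave_profile_def)
next
  fix c :: real assume "c > 0"
  show "strict_antimono_on {0 <..< c / 2} (\<lambda>\<kappa>. crest c \<kappa>)"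
    by (auto simp: monotone_on_def intro!: crest_antimono_kappa)
  show "((\<lambda>\<kappa>. crest c \<kappa>) \<longlongrightarrow> c) (at_right 0)"
    using \<open>c > 0\<close> by (rule crest_tendsto)
next
  fix \<kappa> :: real assume "\<kappa> > 0"
  then show "strict_mono_on {2 * \<kappa> <..} (\<lambda>c. crest c \<kappa>)"
    by (auto simp: monotone_on_def intro!: crest_mono_speed)
qed

end
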